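(* For every $\varepsilon>0$, let $n/\log n\le\Delta\le n-1$, and let $k=\lceil (n-1)/\Delta\rceil$. Then there exists $T\in\mathcal{T}(n,\Delta)$ such that with high probability $G(n,1-n^{-(1-\varepsilon)/k})$ does not contain $T$.
   Context: $\mathcal{T}(n,\Delta)$ denotes the set of all $n$-vertex trees with maximum degree at most $\Delta$. A graph $G$ contains a tree $T$ if $G$ has a (not necessarily induced) subgraph isomorphic to $T$. $G(n,p)$ is the binomial random graph on $n$ labelled vertices in which every pair of vertices is an edge independently with probability $p$. "With high probability" means with probability tending to $1$ as $n\to\infty$; here $\Delta$, $k$ and $T$ may depend on $n$. $\log$ is the natural logarithm. *)

theory Defs
  imports "HOL-Probability.Probability"
begin

datatype 'a graph = Graph (verts: "'a set") (edges: "'a set set")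

definition simple_graph :: "'a graph \<Rightarrow> bool" where
  "simple_graph G \<longleftrightarrow> finite (verts G) \<and> (\<forall>e\<in>edges G. e \<subseteq> verts G \<and> card e = 2)"

definition vertex_degree :: "'a graph \<Rightarrow> 'a \<Rightarrow> nat" where
  "vertex_degree G v = card {e \<in> edges G. v \<in> e}"

(* Only meaningful for graphs with a finite nonempty vertex set, which includes all trees below. *)
definition max_degree :: "'a graph \<Rightarrow> nat" where
  "max_degree G = Max (vertex_degree G ` verts G)"

definition is_walk :: "'a graph \<Rightarrow> 'a list \<Rightarrow> bool" where
  "is_walk G xs \<longleftrightarrow> xs \<noteq> [] \<and> set xs \<subseteq> verts G \<and>
     (\<forall>i. Suc i < length xs \<longrightarrow> {xs ! i, xs ! Suc i} \<in> edges G)"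

definition graph_connected :: "'a graph \<Rightarrow> bool" where
  "graph_connected G \<longleftrightarrow> verts G \<noteq> {} \<and>
     (\<forall>u\<in>verts G. \<forall>v\<in>verts G. \<exists>xs. is_walk G xs \<and> hd xs = u \<and> last xs = v)"

(* A cycle is listed without repeating its initial vertex at the end. *)
definition is_cycle :: "'a graph \<Rightarrow> 'a list \<Rightarrow> bool" where
  "is_cycle G xs \<longleftrightarrow> is_walk G xs \<and> distinct xs \<and> 3 \<le> length xs \<and> {last xs, hd xs} \<in> edges G"

definition is_tree :: "'a graph \<Rightarrow> bool" where
  "is_tree G \<longleftrightarrow> simple_graph G \<and> graph_connected G \<and> (\<nexists>xs. is_cycle G xs)"

(* Every finite graph has an isomorphic copy with vertices in nat, and the containment relation
   below is invariant under isomorphism, so restricting to nat loses nothing. *)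
definition bounded_degree_trees :: "nat \<Rightarrow> nat \<Rightarrow> nat graph set" where
  "bounded_degree_trees n \<Delta> = {T. is_tree T \<and> card (verts T) = n \<and> max_degree T \<le> \<Delta>}"

definition subgraph :: "'a graph \<Rightarrow> 'a graph \<Rightarrow> bool" where
  "subgraph H G \<longleftrightarrow> simple_graph H \<and> verts H \<subseteq> verts G \<and> edges H \<subseteq> edges G"

definition graph_iso :: "'a graph \<Rightarrow> 'b graph \<Rightarrow> bool" where
  "graph_iso G H \<longleftrightarrow> (\<exists>f. bij_betw f (verts G) (verts H) \<and>
     (\<forall>u\<in>verts G. \<forall>v\<in>verts G. {u, v} \<in> edges G \<longleftrightarrow> {f u, f v} \<in> edges H))"

definition contains :: "'a graph \<Rightarrow> 'b graph \<Rightarrow> bool" where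
  "contains G T \<longleftrightarrow> (\<exists>H. subgraph H G \<and> graph_iso T H)"

definition vertex_pairs :: "nat \<Rightarrow> nat set set" where
  "vertex_pairs n = {e. e \<subseteq> {..<n} \<and> card e = 2}"

(* The binomial random graph on the vertex set {0, ..., n - 1}: one independent Bernoulli variable
   for each pair of vertices. Note that bernoulli_pmf truncates its parameter to [0, 1]. *)
definition binomial_random_graph :: "nat \<Rightarrow> real \<Rightarrow> nat graph pmf" where
  "binomial_random_graph n p =
     map_pmf (\<lambda>x. Graph {..<n} {e \<in> vertex_pairs n. x e})
       (Pi_pmf (vertex_pairs n) False (\<lambda>_. bernoulli_pmf p))"

end

(* T consists of k stars of size at most Delta, consecutive ones sharing a leaf, so its k centres
   form a dominating set. A spanning copy of T in G(n,p) would give G(n,p) a dominating set of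
   size k. With q = n^(-(1 - eps)/k) the edge failure probability, a fixed k-set dominates with
   probability (1 - q^k)^(n - k), about exp (-n^eps), which beats the at most
   n^k <= exp ((ln n + 1) * ln n) choices of the set. For eps >= 1 the edge probability is not
   positive and is truncated to 0; replacing eps by min eps (1/2) covers this case. *)
theory Submission
  imports Defs "HOL-Real_Asymp.Real_Asymp"
begin

section \<open>Trees given by a parent function\<close>

text \<open>Vertex 0 is the root. When every parent has a smaller label than its child, connectivity
  becomes an induction on labels and acyclicity a comparison of labels.\<close>

definition parent_graph :: "(nat \<Rightarrow> nat) \<Rightarrow> nat \<Rightarrow> nat graph" where
  "parent_graph f n = Graph {..<n} ((\<lambda>i. {f i, i}) ` {1..<n})"

lemma verts_parent_graph [simp]: "verts (parent_graph f n) = {..<n}"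
  by (simp add: parent_graph_def)

lemma edges_parent_graph: "edges (parent_graph f n) = (\<lambda>i. {f i, i}) ` {1..<n}"
  by (simp add: parent_graph_def)

lemma is_walk_singleton: "v \<in> verts G \<Longrightarrow> is_walk G [v]"
  by (simp add: is_walk_def)

lemma is_walk_Cons:
  assumes "is_walk G xs" "u \<in> verts G" "{u, hd xs} \<in> edges G"
  shows "is_walk G (u # xs)"
  using assms unfolding is_walk_def
  by (auto simp: nth_Cons hd_conv_nth split: nat.splits)

lemma is_walk_snoc:
  assumes "is_walk G xs" "u \<in> verts G" "{last xs, u} \<in> edges G"
  shows "is_walk G (xs @ [u])"
  unfolding is_walk_def
proof (intro conjI allI impI)
  show "set (xs @ [u]) \<subseteq> verts G"
    using assms by (auto simp: is_walk_def)
next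
  fix i assume i: "Suc i < length (xs @ [u])"
  show "{(xs @ [u]) ! i, (xs @ [u]) ! Suc i} \<in> edges G"
  proof (cases "Suc i < length xs")
    case True
    then show ?thesis using assms(1) by (auto simp: is_walk_def nth_append)
  next
    case False
    with i have len: "length xs = Suc i" by simp
    then have "xs ! i = last xs" by (metis diff_Suc_1 last_conv_nth length_0_conv nat.distinct(1))
    with len assms(3) show ?thesis by (simp add: nth_append)
  qed
qed simp

text \<open>Induction on \<open>u + v\<close>: the larger endpoint is replaced by its parent, and
  the walk found is extended at that end.\<close>

lemma parent_graph_walk:
  assumes f: "\<And>i. 0 < i \<Longrightarrow> i < n \<Longrightarrow> f i < i" and "u < n" "v < n"
  shows "\<exists>xs. is_walk (parent_graph f n) xs \<and> hd xs = u \<and> last xs = v"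
  using assms(2,3)
proof (induction "u + v" arbitrary: u v rule: less_induct)
  case less
  let ?G = "parent_graph f n"
  consider "u = v" | "u < v" | "v < u" by linarith
  then show ?case
  proof cases
    case 1
    with less.prems show ?thesis
      by (intro exI[of _ "[u]"]) (simp add: is_walk_singleton)
  next
    case 2
    then have fv: "f v < v" using f less.prems by simp
    with less.prems obtain xs where xs: "is_walk ?G xs" "hd xs = u" "last xs = f v"
      using less.hyps[of u "f v"] by auto
    have "is_walk ?G (xs @ [v])"
      using xs 2 less.prems by (intro is_walk_snoc) (auto simp: edges_parent_graph)
    with xs show ?thesis
      by (intro exI[of _ "xs @ [v]"]) (auto simp: is_walk_def)
  next
    case 3
    then have fu: "f u < u" using f less.prems by simp
    with less.prems obtain xs where xs: "is_walk ?G xs" "hd xs = f u" "last xs = v"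
      using less.hyps[of "f u" v] by auto
    have "{u, f u} = {f u, u}" by auto
    then have "is_walk ?G (u # xs)"
      using xs 3 less.prems by (intro is_walk_Cons) (auto simp: edges_parent_graph)
    with xs show ?thesis
      by (intro exI[of _ "u # xs"]) (auto simp: is_walk_def)
  qed
qed

text \<open>Meant for the largest vertex \<open>m\<close> of a cycle, whose two neighbours then both
  have smaller labels.\<close>

lemma is_cycle_neighbours:
  assumes "is_cycle G xs" "m \<in> set xs"
  obtains a b where "a \<in> set xs" "b \<in> set xs" "a \<noteq> b" "a \<noteq> m" "b \<noteq> m"
    "{a, m} \<in> edges G" "{b, m} \<in> edges G"
proof -
  obtain i where i: "i < length xs" "m = xs ! i"
    using assms(2) by (metis in_set_conv_nth)
  have d: "distinct xs" and len: "3 \<le> length xs"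
    and step: "\<And>j. Suc j < length xs \<Longrightarrow> {xs ! j, xs ! Suc j} \<in> edges G"
    and close: "{xs ! (length xs - 1), xs ! 0} \<in> edges G"
    using assms(1)
    by (auto simp: is_cycle_def is_walk_def last_conv_nth hd_conv_nth)
  \<comment> \<open>Cyclic predecessor and successor of position \<open>i\<close>; they differ
    because the length is at least 3.\<close>
  define p where "p = (if i = 0 then length xs - 1 else i - 1)"
  define s where "s = (if i = length xs - 1 then 0 else Suc i)"
  have ps: "p < length xs" "s < length xs" "p \<noteq> s" "p \<noteq> i" "s \<noteq> i"
    using i len by (auto simp: p_def s_def split: if_splits)
  show thesis
  proof (rule that[of "xs ! p" "xs ! s"])
    show "{xs ! p, m} \<in> edges G"
      using step[of "i - 1"] close i by (auto simp: p_def)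
    show "{xs ! s, m} \<in> edges G"
      using step[of i] close i by (auto simp: s_def insert_commute)
  qed (use ps i d in \<open>auto simp: nth_eq_iff_index_eq\<close>)
qed

text \<open>The largest vertex of a cycle would have two distinct smaller neighbours, but the only
  smaller neighbour of a vertex is its parent.\<close>

lemma is_tree_parent_graph:
  assumes f: "\<And>i. 0 < i \<Longrightarrow> i < n \<Longrightarrow> f i < i" and "0 < n"
  shows "is_tree (parent_graph f n)"
  unfolding is_tree_def
proof (intro conjI notI)
  show "simple_graph (parent_graph f n)"
    unfolding simple_graph_def
  proof (intro conjI ballI)
    fix e assume "e \<in> edges (parent_graph f n)"
    then obtain i where i: "e = {f i, i}" "0 < i" "i < n"
      by (auto simp: edges_parent_graph)
    with f[of i] show "e \<subseteq> verts (parent_graph f n)" "card e = 2"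
      by auto
  qed simp
  show "graph_connected (parent_graph f n)"
    using parent_graph_walk[of n f] assms by (auto simp: graph_connected_def)
next
  assume "\<exists>xs. is_cycle (parent_graph f n) xs"
  then obtain xs where cyc: "is_cycle (parent_graph f n) xs" ..
  define m where "m = Max (set xs)"
  have ne: "set xs \<noteq> {}" using cyc by (auto simp: is_cycle_def is_walk_def)
  then have "m \<in> set xs" by (simp add: m_def)
  then obtain a b where ab: "a \<in> set xs" "b \<in> set xs" "a \<noteq> b" "a \<noteq> m" "b \<noteq> m"
    "{a, m} \<in> edges (parent_graph f n)" "{b, m} \<in> edges (parent_graph f n)"
    using is_cycle_neighbours[OF cyc] by metis
  \<comment> \<open>Each edge is indexed by its larger endpoint, which in \<open>{x, m}\<close> is
    \<open>m\<close>.\<close>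
  have parent: "x = f m"
    if x: "x \<in> set xs" "x \<noteq> m" "{x, m} \<in> edges (parent_graph f n)" for x
  proof -
    have "x < m" using x ne by (simp add: m_def order_less_le)
    obtain i where i: "{x, m} = {f i, i}" "i \<in> {1..<n}"
      using x(3) unfolding edges_parent_graph by (rule imageE)
    then have "f i < i" using f by simp
    from i(1) have "x = f i \<and> m = i \<or> x = i \<and> m = f i"
      by (simp only: doubleton_eq_iff)
    with \<open>x < m\<close> \<open>f i < i\<close> show ?thesis by (elim disjE conjE) simp_all
  qed
  show False using parent[OF ab(1,4,6)] parent[OF ab(2,5,7)] ab(3) by metis
qed

section \<open>A tree with a small dominating set\<close>

definition dominating :: "'a graph \<Rightarrow> 'a set \<Rightarrow> bool" where
  "dominating G S \<longleftrightarrow> S \<subseteq> verts G \<and> (\<forall>v\<in>verts G - S. \<exists>s\<in>S. {s, v} \<in> edges G)"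

text \<open>With equally many vertices, the copy of \<open>T\<close> spans \<open>G\<close>. The
  image of \<open>C\<close> then dominates the copy, hence also \<open>G\<close>, which has at least
  its edges.\<close>

lemma contains_dominating:
  assumes cont: "contains G T" and fin: "finite (verts G)"
    and card: "card (verts T) = card (verts G)" and dom: "dominating T C"
  shows "\<exists>S. card S = card C \<and> dominating G S"
proof -
  obtain H g where H: "verts H \<subseteq> verts G" "edges H \<subseteq> edges G"
    and g: "bij_betw g (verts T) (verts H)"
    and iso: "\<And>u v. u \<in> verts T \<Longrightarrow> v \<in> verts T \<Longrightarrow>
      {u, v} \<in> edges T \<longleftrightarrow> {g u, g v} \<in> edges H"
    using cont by (auto simp: contains_def subgraph_def graph_iso_def)
  have "card (verts H) = card (verts G)"
    using bij_betw_same_card[OF g] card by simp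
  then have VH: "verts H = verts G"
    using H(1) fin by (simp add: card_subset_eq)
  have C: "C \<subseteq> verts T" using dom by (simp add: dominating_def)
  have "inj_on g C" using g C by (meson bij_betw_def inj_on_subset)
  then have "card (g ` C) = card C" by (rule card_image)
  moreover have "dominating G (g ` C)"
    unfolding dominating_def
  proof (intro conjI ballI)
    show "g ` C \<subseteq> verts G" using C g VH by (auto simp: bij_betw_def)
  next
    fix v assume v: "v \<in> verts G - g ` C"
    have "v \<in> g ` verts T" using v g VH by (simp add: bij_betw_def)
    then obtain u where u: "u \<in> verts T" "v = g u" by blast
    with v have "u \<in> verts T - C" by auto
    then obtain c where c: "c \<in> C" "{c, u} \<in> edges T"
      using dom by (auto simp: dominating_def)
    with C u iso have "{g c, v} \<in> edges H" by blast
    with H(2) c(1) show "\<exists>s\<in>g ` C. {s, v} \<in> edges G" by blast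
  qed
  ultimately show ?thesis by blast
qed

section \<open>Degrees and dominating centres of the chain of stars\<close>

text \<open>The edges \<open>{f i, i}\<close> with \<open>i\<close> in the block \<open>{j * D + 1..(j + 1) * D}\<close> form a star
  with centre \<open>j * D + 1\<close>; the last vertex of a block is shared with the next star.\<close>

definition star_parent :: "nat \<Rightarrow> nat \<Rightarrow> nat" where
  "star_parent D i = (if (i - 1) mod D = 0 then i - 1 else (i - 1) div D * D + 1)"

lemma star_parent_less:
  assumes "0 < i"
  shows "star_parent D i < i"
proof -
  have "(i - 1) div D * D + (i - 1) mod D = i - 1" by (rule div_mult_mod_eq)
  then have "(i - 1) div D * D + 1 < i" if "(i - 1) mod D \<noteq> 0"
    using that assms by linarith
  with assms show ?thesis by (simp add: star_parent_def)
qed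

text \<open>The first vertex of a block is the centre itself; every other vertex of the block has
  the centre as parent.\<close>

lemma star_edge_centre:
  assumes "0 < i"
  shows "(i - 1) div D * D + 1 \<in> {star_parent D i, i}"
proof (cases "(i - 1) mod D = 0")
  case True
  then have "(i - 1) div D * D = i - 1" by (metis add.right_neutral div_mult_mod_eq)
  with assms show ?thesis by simp
qed (simp add: star_parent_def)

text \<open>The two bounds on \<open>k\<close> say that it is the ceiling of
  \<open>(n - 1) / D\<close>: the first makes \<open>k\<close> blocks cover all edges, the second
  makes the last block nonempty, so that every centre is a vertex.\<close>

lemma dominating_star_parent:
  assumes D: "0 < D" and n: "2 \<le> n" and k: "n - 1 \<le> k * D" "(k - 1) * D < n - 1"
  shows "dominating (parent_graph (star_parent D) n) ((\<lambda>j. j * D + 1) ` {..<k})"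
  unfolding dominating_def
proof (intro conjI ballI)
  have "j * D + 1 < n" if "j < k" for j
  proof -
    have "j * D \<le> (k - 1) * D" using that by (intro mult_le_mono1) simp
    with k(2) show ?thesis by linarith
  qed
  then show "(\<lambda>j. j * D + 1) ` {..<k} \<subseteq> verts (parent_graph (star_parent D) n)"
    by auto
next
  let ?C = "(\<lambda>j. j * D + 1) ` {..<k}"
  fix v assume v: "v \<in> verts (parent_graph (star_parent D) n) - ?C"
  \<comment> \<open>Vertex 0 has no parent edge, so it is treated through the edge of its child
    1.\<close>
  define i where "i = (if v = 0 then 1 else v)"
  have i: "0 < i" "i < n" using v n by (auto simp: i_def)
  have edge: "{star_parent D i, i} \<in> edges (parent_graph (star_parent D) n)"
    using i by (auto simp: edges_parent_graph)
  have "v \<in> {star_parent D i, i}" by (auto simp: i_def star_parent_def)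
  moreover define c where "c = (i - 1) div D * D + 1"
  have "(i - 1) div D < k"
    using i k by (intro less_mult_imp_div_less) simp
  then have c: "c \<in> ?C"
    by (intro image_eqI[where x = "(i - 1) div D"]) (simp_all add: c_def)
  moreover have "c \<in> {star_parent D i, i}"
    unfolding c_def using i(1) by (rule star_edge_centre)
  moreover have "c \<noteq> v" using c v by auto
  ultimately have "{c, v} = {star_parent D i, i}" by auto
  with edge have "{c, v} \<in> edges (parent_graph (star_parent D) n)" by simp
  with c show "\<exists>s\<in>?C. {s, v} \<in> edges (parent_graph (star_parent D) n)" by (rule bexI[rotated])
qed

text \<open>Edges are counted by their child \<open>i\<close>. For a centre these \<open>i\<close>
  lie in its own block, of size \<open>D\<close>; any other \<open>v\<close> lies at most on its own
  parent edge and on that of \<open>v + 1\<close>.\<close>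

lemma vertex_degree_star_parent:
  assumes D: "2 \<le> D"
  shows "vertex_degree (parent_graph (star_parent D) n) v \<le> D"
proof -
  have "\<exists>I. finite I \<and> card I \<le> D \<and>
    (\<forall>i. 0 < i \<longrightarrow> v \<in> {star_parent D i, i} \<longrightarrow> i \<in> I)"
  proof (cases "\<exists>j. v = j * D + 1")
    case True
    then obtain j where j: "v = j * D + 1" ..
    have "i \<in> {j * D + 1..j * D + D}" if "0 < i" "v \<in> {star_parent D i, i}" for i
    proof -
      have dm: "(i - 1) div D * D + (i - 1) mod D = i - 1" by simp
      have lt: "(i - 1) mod D < D" using D by simp
      \<comment> \<open>As \<open>D\<close> is at least 2, a centre is never the shared leaf
        \<open>i - 1\<close> that serves as parent of the next centre.\<close>
      have "(j * D + 1) mod D = 1 mod D" by (rule mod_mult_self3)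
      then have "(j * D + 1) mod D \<noteq> 0" using D by simp
      then have "(i - 1) div D = j"
        using that j D by (auto simp: star_parent_def split: if_splits)
      with dm have "j * D + (i - 1) mod D = i - 1" by (simp only:)
      with lt that(1) have "j * D + 1 \<le> i" "i \<le> j * D + D" by linarith+
      then show ?thesis by simp
    qed
    then show ?thesis by (intro exI[of _ "{j * D + 1..j * D + D}"]) auto
  next
    case False
    have "i \<in> {v, v + 1}" if "0 < i" "v \<in> {star_parent D i, i}" for i
      using that False by (auto simp: star_parent_def split: if_splits)
    moreover have "card {v, v + 1} \<le> D" using D by simp
    ultimately show ?thesis by (intro exI[of _ "{v, v + 1}"]) auto
  qed
  then obtain I where I: "finite I" "card I \<le> D"
    "\<And>i. 0 < i \<Longrightarrow> v \<in> {star_parent D i, i} \<Longrightarrow> i \<in> I" by blast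
  have "{e \<in> edges (parent_graph (star_parent D) n). v \<in> e} \<subseteq> (\<lambda>i. {star_parent D i, i}) ` I"
    using I(3) by (auto simp: edges_parent_graph)
  then have "vertex_degree (parent_graph (star_parent D) n) v \<le> card I"
    unfolding vertex_degree_def using I(1) by (rule surj_card_le[rotated])
  with I(2) show ?thesis by simp
qed

lemma star_tree_bounded_degree:
  assumes "2 \<le> D" "0 < n"
  shows "parent_graph (star_parent D) n \<in> bounded_degree_trees n D"
proof -
  let ?T = "parent_graph (star_parent D) n"
  have "is_tree ?T"
    using assms(2) star_parent_less by (intro is_tree_parent_graph)
  moreover have "max_degree ?T \<le> D"
    unfolding max_degree_def using assms vertex_degree_star_parent by (subst Max_le_iff) auto
  ultimately show ?thesis by (simp add: bounded_degree_trees_def)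
qed

section \<open>Dominating sets in the binomial random graph\<close>

lemma measure_pair_pmf_Times:
  "measure_pmf.prob (pair_pmf M N) (A \<times> B) = measure_pmf.prob M A * measure_pmf.prob N B"
proof -
  \<comment> \<open>Cutting down to the supports makes both factors countable, as the product rule
    applied below demands.\<close>
  have "measure_pmf.prob (pair_pmf M N) (A \<times> B) =
      measure_pmf.prob (pair_pmf M N) ((A \<inter> set_pmf M) \<times> (B \<inter> set_pmf N))"
    by (subst measure_Int_set_pmf [symmetric]) (auto intro: arg_cong[where f = "measure _"])
  then show ?thesis
    by (simp add: measure_pmf_prob_product measure_Int_set_pmf countable_Int2)
qed

text \<open>The last two hypotheses express that \<open>P\<close> reads only coordinates in
  \<open>A\<close> and \<open>Q\<close> only those in \<open>B\<close>. Gluing functions on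
  \<open>A\<close> and \<open>B\<close> then pulls the joint event back to a rectangle.\<close>

lemma measure_Pi_pmf_union:
  assumes "finite A" "finite B" "A \<inter> B = {}"
    and P: "\<And>x y. (\<And>e. e \<in> A \<Longrightarrow> x e = y e) \<Longrightarrow> P x = P y"
    and Q: "\<And>x y. (\<And>e. e \<in> B \<Longrightarrow> x e = y e) \<Longrightarrow> Q x = Q y"
  shows "measure_pmf.prob (Pi_pmf (A \<union> B) d p) {x. P x \<and> Q x} =
    measure_pmf.prob (Pi_pmf A d p) {x. P x} * measure_pmf.prob (Pi_pmf B d p) {x. Q x}"
proof -
  have "P (\<lambda>x. if x \<in> A then f x else g x) = P f" for f g by (rule P) simp
  moreover have "Q (\<lambda>x. if x \<in> A then f x else g x) = Q g" for f g
    using assms(3) by (intro Q) auto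
  ultimately have "(\<lambda>(f, g) x. if x \<in> A then f x else g x) -` {x. P x \<and> Q x} = {x. P x} \<times> {x. Q x}"
    by auto
  then show ?thesis
    using assms(1-3) by (simp add: Pi_pmf_union measure_pair_pmf_Times)
qed

text \<open>The complement is the event that every coordinate in \<open>E\<close> is
  \<open>False\<close>. Writing the failure probability as a \<open>pmf\<close> value rather than
  \<open>1 - p\<close> keeps the formula valid under truncation of \<open>p\<close>.\<close>

lemma prob_bernoulli_ex:
  assumes "finite E"
  shows "measure_pmf.prob (Pi_pmf E d (\<lambda>_. bernoulli_pmf p)) {x. \<exists>e\<in>E. x e} =
    1 - pmf (bernoulli_pmf p) False ^ card E"
proof -
  have "{x. \<exists>e\<in>E. x e} = UNIV - Pi E (\<lambda>_. {False})" by auto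
  then show ?thesis
    using assms measure_pmf.prob_compl[of "Pi E (\<lambda>_. {False})" "Pi_pmf E d (\<lambda>_. bernoulli_pmf p)"]
    by (simp add: measure_Pi_pmf_Pi measure_pmf_single)
qed

text \<open>Induction on \<open>I\<close>, splitting off the coordinates \<open>E i\<close> by
  independence. The ambient set \<open>A\<close> varies in the induction, since the remaining family
  lives on \<open>A - E i\<close>.\<close>

lemma prob_bernoulli_all_ex:
  assumes "finite I" "finite A" "\<And>i. i \<in> I \<Longrightarrow> E i \<subseteq> A" "disjoint_family_on E I"
  shows "measure_pmf.prob (Pi_pmf A d (\<lambda>_. bernoulli_pmf p)) {x. \<forall>i\<in>I. \<exists>e\<in>E i. x e} =
    (\<Prod>i\<in>I. 1 - pmf (bernoulli_pmf p) False ^ card (E i))"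
  using assms
proof (induction I arbitrary: A rule: finite_induct)
  case empty
  then show ?case by simp
next
  case (insert i I)
  let ?M = "\<lambda>A. Pi_pmf A d (\<lambda>_. bernoulli_pmf p)"
  have dj: "E j \<inter> E i = {}" if "j \<in> I" for j
    using insert.prems(3) insert.hyps(2) that by (auto simp: disjoint_family_on_def)
  then have sub: "E j \<subseteq> A - E i" if "j \<in> I" for j
    using insert.prems(2) that by blast
  have fin: "finite (E i)" using insert.prems by (meson finite_subset insertI1)
  have "A = E i \<union> (A - E i)" using insert.prems(2) by auto
  then have "measure_pmf.prob (?M A) {x. \<forall>i\<in>insert i I. \<exists>e\<in>E i. x e} =
      measure_pmf.prob (?M (E i \<union> (A - E i))) {x. (\<exists>e\<in>E i. x e) \<and> (\<forall>i\<in>I. \<exists>e\<in>E i. x e)}"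
    by simp
  also have "\<dots> = measure_pmf.prob (?M (E i)) {x. \<exists>e\<in>E i. x e} *
      measure_pmf.prob (?M (A - E i)) {x. \<forall>i\<in>I. \<exists>e\<in>E i. x e}"
  proof (rule measure_Pi_pmf_union)
    fix x y :: "'b \<Rightarrow> bool" assume "\<And>e. e \<in> A - E i \<Longrightarrow> x e = y e"
    with sub show "(\<forall>i\<in>I. \<exists>e\<in>E i. x e) = (\<forall>i\<in>I. \<exists>e\<in>E i. y e)"
      by (intro ball_cong bex_cong) blast+
  qed (use fin insert.prems in auto)
  also have "measure_pmf.prob (?M (A - E i)) {x. \<forall>i\<in>I. \<exists>e\<in>E i. x e} =
      (\<Prod>i\<in>I. 1 - pmf (bernoulli_pmf p) False ^ card (E i))"
    using insert.prems sub
    by (intro insert.IH) (auto simp: disjoint_family_on_def)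
  finally show ?case
    using insert.hyps fin by (simp add: prob_bernoulli_ex)
qed

section \<open>First moment bound for dominating sets of size k\<close>

lemma finite_vertex_pairs: "finite (vertex_pairs n)"
  by (rule finite_subset[of _ "Pow {..<n}"]) (auto simp: vertex_pairs_def)

lemma verts_binomial_random_graph:
  "G \<in> set_pmf (binomial_random_graph n p) \<Longrightarrow> verts G = {..<n}"
  by (auto simp: binomial_random_graph_def)

text \<open>Each vertex outside \<open>S\<close> needs at least one of its \<open>card S\<close>
  pairs to \<open>S\<close> to be an edge, and for different vertices these sets of pairs are
  disjoint, so the probabilities multiply.\<close>

lemma prob_dominating:
  assumes S: "S \<subseteq> {..<n}"
  shows "measure_pmf.prob (binomial_random_graph n p) {G. dominating G S} =
    (1 - pmf (bernoulli_pmf p) False ^ card S) ^ (n - card S)"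
proof -
  let ?E = "\<lambda>v. (\<lambda>s. {s, v}) ` S"
  have finS: "finite S" using S by (rule finite_subset) simp
  have sub: "?E v \<subseteq> vertex_pairs n" if "v \<in> {..<n} - S" for v
    using that S by (auto simp: vertex_pairs_def card_2_iff)
  have "dominating (Graph {..<n} {e \<in> vertex_pairs n. x e}) S \<longleftrightarrow>
      (\<forall>v\<in>{..<n} - S. \<exists>e\<in>?E v. x e)" for x
  proof -
    have "{s, v} \<in> {e \<in> vertex_pairs n. x e} \<longleftrightarrow> x {s, v}"
      if "v \<in> {..<n} - S" "s \<in> S" for s v
      using sub[OF that(1)] that(2) by blast
    with S show ?thesis by (simp add: dominating_def)
  qed
  then have "measure_pmf.prob (binomial_random_graph n p) {G. dominating G S} =
      measure_pmf.prob (Pi_pmf (vertex_pairs n) False (\<lambda>_. bernoulli_pmf p))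
        {x. \<forall>v\<in>{..<n} - S. \<exists>e\<in>?E v. x e}"
    by (simp add: binomial_random_graph_def)
  also have "\<dots> = (\<Prod>v\<in>{..<n} - S. 1 - pmf (bernoulli_pmf p) False ^ card (?E v))"
  proof (rule prob_bernoulli_all_ex[OF _ finite_vertex_pairs sub])
    \<comment> \<open>A pair in \<open>?E v\<close> has exactly one vertex outside \<open>S\<close>,
      namely \<open>v\<close>, so it determines \<open>v\<close>.\<close>
    show "disjoint_family_on ?E ({..<n} - S)"
      by (auto simp: disjoint_family_on_def doubleton_eq_iff)
  qed simp
  also have "\<dots> = (\<Prod>v\<in>{..<n} - S. 1 - pmf (bernoulli_pmf p) False ^ card S)"
  proof (intro prod.cong refl)
    fix v
    have "inj_on (\<lambda>s. {s, v}) S" by (auto simp: inj_on_def doubleton_eq_iff)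
    then show "1 - pmf (bernoulli_pmf p) False ^ card (?E v) = 1 - pmf (bernoulli_pmf p) False ^ card S"
      by (simp add: card_image)
  qed
  also have "\<dots> = (1 - pmf (bernoulli_pmf p) False ^ card S) ^ (n - card S)"
    using S finS by (simp add: card_Diff_subset)
  finally show ?thesis .
qed

lemma prob_ex_dominating_le:
  assumes "k \<le> n"
  shows "measure_pmf.prob (binomial_random_graph n p) {G. \<exists>S. card S = k \<and> dominating G S} \<le>
    real n ^ k * (1 - pmf (bernoulli_pmf p) False ^ k) ^ (n - k)"
proof -
  let ?M = "binomial_random_graph n p" and ?\<S> = "{S. S \<subseteq> {..<n} \<and> card S = k}"
  have fin: "finite ?\<S>" by simp
  have "measure_pmf.prob ?M {G. \<exists>S. card S = k \<and> dominating G S} \<le>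
      measure_pmf.prob ?M (\<Union>S\<in>?\<S>. {G. dominating G S})"
    \<comment> \<open>The inclusion holds only on the support, where the vertex set is
      \<open>{..<n}\<close> and so contains \<open>S\<close>.\<close>
    by (intro measure_pmf.finite_measure_mono_AE)
      (auto simp: AE_measure_pmf_iff dominating_def dest: verts_binomial_random_graph)
  also have "\<dots> \<le> (\<Sum>S\<in>?\<S>. measure_pmf.prob ?M {G. dominating G S})"
    using fin by (intro measure_pmf.finite_measure_subadditive_finite) auto
  also have "\<dots> = (\<Sum>S\<in>?\<S>. (1 - pmf (bernoulli_pmf p) False ^ k) ^ (n - k))"
    by (intro sum.cong refl) (auto simp: prob_dominating)
  also have "\<dots> = real (n choose k) * (1 - pmf (bernoulli_pmf p) False ^ k) ^ (n - k)"
    using n_subsets[of "{..<n}" k] by simp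
  also have "\<dots> \<le> real (n ^ k) * (1 - pmf (bernoulli_pmf p) False ^ k) ^ (n - k)"
    using binomial_le_pow[OF assms]
    by (intro mult_right_mono zero_le_power) (auto simp: power_le_one pmf_le_1)
  finally show ?thesis by simp
qed

text \<open>The minimum accounts for negative \<open>p\<close>, where truncation caps the failure
  probability at 1.\<close>

lemma pmf_bernoulli_False_ge: "min 1 (1 - p) \<le> pmf (bernoulli_pmf p) False"
  by (simp add: bernoulli_pmf.rep_eq)

lemma prob_contains_star_tree_le:
  assumes "0 < D" "2 \<le> n" and k: "n - 1 \<le> k * D" "(k - 1) * D < n - 1"
  shows "measure_pmf.prob (binomial_random_graph n p) {G. contains G (parent_graph (star_parent D) n)} \<le>
    real n ^ k * (1 - pmf (bernoulli_pmf p) False ^ k) ^ (n - k)"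
proof -
  let ?T = "parent_graph (star_parent D) n" and ?C = "(\<lambda>j. j * D + 1) ` {..<k}"
  have "k - 1 \<le> (k - 1) * D" using assms(1) by simp
  with k(2) have "k \<le> n" by linarith
  have "inj_on (\<lambda>j. j * D + 1) {..<k}" using assms(1) by (simp add: inj_on_def)
  then have card: "card ?C = k" by (simp add: card_image)
  have "\<exists>S. card S = k \<and> dominating G S"
    if "G \<in> set_pmf (binomial_random_graph n p)" "contains G ?T" for G
    using contains_dominating[OF that(2), of ?C] dominating_star_parent[OF assms] card
      verts_binomial_random_graph[OF that(1)] by simp
  then have "measure_pmf.prob (binomial_random_graph n p) {G. contains G ?T} \<le>
      measure_pmf.prob (binomial_random_graph n p) {G. \<exists>S. card S = k \<and> dominating G S}"
    by (intro measure_pmf.finite_measure_mono_AE) (auto simp: AE_measure_pmf_iff)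
  also note prob_ex_dominating_le[OF \<open>k \<le> n\<close>]
  finally show ?thesis .
qed

section \<open>Asymptotics of the union bound\<close>

lemma union_bound_le_exp:
  fixes e q :: real and n k :: nat
  assumes "1 \<le> n" "1 \<le> k" "k \<le> n" "real k \<le> ln (real n) + 1"
    and q: "real n powr (- (1 - e) / real k) \<le> q" "q \<le> 1"
  shows "real n ^ k * (1 - q ^ k) ^ (n - k) \<le>
    exp ((ln (real n) + 1) * ln (real n) - real n powr (- (1 - e)) * (real n - (ln (real n) + 1)))"
proof -
  let ?a = "real n powr (- (1 - e))"
  \<comment> \<open>The factor \<open>1 / k\<close> in the exponent cancels here, so that
    \<open>q ^ k\<close> is at least \<open>?a\<close>, a quantity free of \<open>k\<close>.\<close>
  have "?a = (real n powr (- (1 - e) / real k)) ^ k"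
    using assms(1,2) by (simp add: powr_power)
  also have "\<dots> \<le> q ^ k" using q(1) by (intro power_mono) auto
  finally have "1 - q ^ k \<le> exp (- ?a)"
    using exp_ge_add_one_self[of "- ?a"] by linarith
  moreover have "0 \<le> q" using q(1) by (rule order_trans[rotated]) simp
  ultimately have "(1 - q ^ k) ^ (n - k) \<le> exp (- ?a) ^ (n - k)"
    using q(2) by (intro power_mono) (auto simp: power_le_one)
  also have "\<dots> = exp (- (?a * (real n - real k)))"
    using assms(3) by (simp add: exp_of_nat_mult [symmetric] of_nat_diff algebra_simps)
  \<comment> \<open>Replacing \<open>k\<close> by its upper bound leaves an estimate in
    \<open>n\<close> alone, whose limit can be computed.\<close>
  also have "\<dots> \<le> exp (- (?a * (real n - (ln (real n) + 1))))"
    using assms(4) by (simp add: mult_left_mono)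
  finally have A: "(1 - q ^ k) ^ (n - k) \<le> exp (- (?a * (real n - (ln (real n) + 1))))" .
  have "real n ^ k = exp (real k * ln (real n))"
    using assms(1) by (simp add: exp_of_nat_mult)
  also have "\<dots> \<le> exp ((ln (real n) + 1) * ln (real n))"
    using assms(1,4) by (simp add: mult_right_mono)
  finally have "real n ^ k * (1 - q ^ k) ^ (n - k) \<le>
      exp ((ln (real n) + 1) * ln (real n)) * exp (- (?a * (real n - (ln (real n) + 1))))"
    using A by (intro mult_mono) (auto simp: \<open>0 \<le> q\<close> q(2) power_le_one)
  then show ?thesis by (simp add: exp_add [symmetric])
qed

theorem theorem1p3:
  fixes \<epsilon> :: real and \<Delta> k :: "nat \<Rightarrow> nat"
  assumes "\<epsilon> > 0"
    and "\<forall>\<^sub>F n in sequentially. real n / ln (real n) \<le> real (\<Delta> n) \<and> real (\<Delta> n) \<le> real n - 1"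
    and "\<And>n. k n = nat \<lceil>(real n - 1) / real (\<Delta> n)\<rceil>"
  shows "\<exists>T :: nat \<Rightarrow> nat graph.
           (\<forall>\<^sub>F n in sequentially. T n \<in> bounded_degree_trees n (\<Delta> n)) \<and>
           (\<lambda>n. measure_pmf.prob (binomial_random_graph n (1 - real n powr (- (1 - \<epsilon>) / real (k n))))
                  {G. \<not> contains G (T n)}) \<longlonglongrightarrow> 1"
proof -
  define e where "e = min \<epsilon> (1 / 2)"
  have e: "0 < e" "e < 1" "e \<le> \<epsilon>" using assms(1) by (auto simp: e_def)
  define T where "T = (\<lambda>n. parent_graph (star_parent (\<Delta> n)) n)"
  define p where "p = (\<lambda>n. 1 - real n powr (- (1 - \<epsilon>) / real (k n)))"
  define b where "b = (\<lambda>n. exp ((ln (real n) + 1) * ln (real n) -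
    real n powr (- (1 - e)) * (real n - (ln (real n) + 1))))"
  \<comment> \<open>In the exponent, the negative term of order \<open>n powr e\<close> outweighs
    the squared logarithm.\<close>
  have b: "b \<longlonglongrightarrow> 0" unfolding b_def using e by real_asymp
  \<comment> \<open>This forces \<open>\<Delta> n\<close> to be at least 2, as the degree bound for
    the chain of stars requires.\<close>
  have "\<forall>\<^sub>F n in sequentially. 2 \<le> real n / ln (real n)" by real_asymp
  then have large: "\<forall>\<^sub>F n in sequentially. 3 \<le> n \<and> 2 \<le> \<Delta> n \<and>
      real n / ln (real n) \<le> real (\<Delta> n)"
    using assms(2) eventually_ge_at_top[of "3::nat"] by eventually_elim auto
  then have trees: "\<forall>\<^sub>F n in sequentially. T n \<in> bounded_degree_trees n (\<Delta> n)"
    by eventually_elim (simp add: T_def star_tree_bounded_degree)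
  have "\<forall>\<^sub>F n in sequentially. measure_pmf.prob (binomial_random_graph n (p n)) {G. contains G (T n)} \<le> b n"
    using large
  proof eventually_elim
    case (elim n)
    let ?x = "(real n - 1) / real (\<Delta> n)"
    have x: "0 < ?x" using elim by simp
    \<comment> \<open>The ceiling inequalities, to be turned into the two integer bounds
      \<open>k1\<close> and \<open>k2\<close> that place the centres.\<close>
    then have k: "real (k n) < ?x + 1" "?x \<le> real (k n)" "1 \<le> k n"
      unfolding assms(3) by linarith+
    have "real (n - 1) \<le> real (k n * \<Delta> n)"
      using k(2) elim by (simp add: divide_le_eq)
    then have k1: "n - 1 \<le> k n * \<Delta> n" by (simp only: of_nat_le_iff)
    have "real (k n) - 1 < ?x" using k(1) by simp
    then have "real ((k n - 1) * \<Delta> n) < real (n - 1)"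
      using k(3) elim by (simp add: less_divide_eq of_nat_diff)
    then have k2: "(k n - 1) * \<Delta> n < n - 1" by (simp only: of_nat_less_iff)
    have "k n - 1 \<le> (k n - 1) * \<Delta> n" using elim by simp
    with k2 have kn: "k n \<le> n" by linarith
    have ln: "0 < ln (real n)" using elim by simp
    \<comment> \<open>The lower bound on \<open>\<Delta> n\<close> enters here: it keeps the number
      of centres logarithmic.\<close>
    have "?x \<le> real n / real (\<Delta> n)" by (intro divide_right_mono) auto
    also have "\<dots> \<le> ln (real n)" using elim ln by (simp add: field_simps)
    finally have kln: "real (k n) \<le> ln (real n) + 1" using k(1) by linarith
    let ?q = "pmf (bernoulli_pmf (p n)) False"
    \<comment> \<open>The lower bound for \<open>?q\<close> is a minimum, so both of its arguments
      must be compared: \<open>1 - p n\<close> by \<open>e \<le> \<epsilon>\<close>, and 1 by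
      \<open>e < 1\<close>.\<close>
    have "real n powr (- (1 - e) / real (k n)) \<le> real n powr (- (1 - \<epsilon>) / real (k n))"
      using elim e by (intro powr_mono divide_right_mono) auto
    moreover have "real n powr (- (1 - e) / real (k n)) \<le> real n powr 0"
      using elim e by (intro powr_mono divide_nonpos_nonneg) auto
    moreover have "real n powr 0 = 1" using elim by simp
    ultimately have q: "real n powr (- (1 - e) / real (k n)) \<le> ?q"
      using pmf_bernoulli_False_ge[of "p n"] by (simp add: p_def)
    have "measure_pmf.prob (binomial_random_graph n (p n)) {G. contains G (T n)} \<le>
        real n ^ k n * (1 - ?q ^ k n) ^ (n - k n)"
      unfolding T_def using elim k1 k2 by (intro prob_contains_star_tree_le) auto
    also have "\<dots> \<le> b n"
      unfolding b_def using elim k(3) kn kln q pmf_le_1 by (intro union_bound_le_exp) auto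
    finally show ?case .
  qed
  then have "(\<lambda>n. measure_pmf.prob (binomial_random_graph n (p n)) {G. contains G (T n)}) \<longlonglongrightarrow> 0"
    by (intro tendsto_sandwich[OF _ _ tendsto_const b]) auto
  then have "(\<lambda>n. 1 - measure_pmf.prob (binomial_random_graph n (p n)) {G. contains G (T n)}) \<longlonglongrightarrow> 1 - 0"
    by (intro tendsto_diff tendsto_const)
  moreover have "1 - measure_pmf.prob (binomial_random_graph n (p n)) {G. contains G (T n)} =
      measure_pmf.prob (binomial_random_graph n (p n)) {G. \<not> contains G (T n)}" for n
    using measure_pmf.prob_compl[of "{G. contains G (T n)}" "binomial_random_graph n (p n)"]
    by (simp add: Compl_eq_Diff_UNIV [symmetric] Collect_neg_eq)
  ultimately have "(\<lambda>n. measure_pmf.prob (binomial_random_graph n (p n)) {G. \<not> contains G (T n)}) \<longlonglongrightarrow> 1"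
    by simp
  with trees show ?thesis unfolding p_def by blast
qed

end
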